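(* Let $(\mathcal G,\rho,\omega)$ be a symplectic Lie--Rinehart--Jacobi algebra over $A$, with associated $1$-cocycle $\chi$ and associated Lie--Rinehart algebra $(\mathcal G,\bar\rho)$, and assume $\chi=u^{-1}d_{\bar\rho}u$ (i.e. $\chi(x)=u^{-1}\bar\rho(x)(u)$ for all $x\in\mathcal G$) for some unit $u\in A^\times$. Then: (i) $\rho(x)=L_{u^{-1}}\circ\bar\rho(x)\circ L_u$ for all $x\in\mathcal G$; (ii) $\beta\mapsto u\beta$ is an isomorphism of complexes $(C^\bullet_\rho(\mathcal G,A),d_\rho)\to(C^\bullet_{\bar\rho}(\mathcal G,A),d_{\bar\rho})$; (iii) $\Omega=u\,\omega$ is a symplectic form on the Lie--Rinehart algebra $(\mathcal G,\bar\rho)$, and $X_a=X^\Omega_{ua}$ for all $a\in A$; (iv) $a\mapsto ua$ is a Lie algebra isomorphism $(A,\{\,,\}_\omega)\to(A,\{\,,\}_\Omega)$ from the Jacobi algebra of $\omega$ onto the Poisson algebra of $\Omega$.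
   Context: $K$ is a commutative field of characteristic zero and $A$ a commutative unital $K$-algebra; $L_a$ is multiplication by $a\in A$. $\mathrm{Diff}^1_K(A)$ is the set of $K$-linear $D:A\to A$ with $[[D,L_a],L_b]=0$ for all $a,b\in A$ (equivalently $D(ab)=D(a)b+aD(b)-abD(1_A)$). A Lie--Rinehart--Jacobi (LRJ) algebra over $A$ is an $A$-module $\mathcal G$ with a $K$-Lie algebra structure and an $A$-linear map (anchor) $\rho:\mathcal G\to\mathrm{Diff}^1_K(A)$ which is a Lie algebra morphism and satisfies $[x,ay]=a[x,y]+(\rho(x)(a)-a\rho(x)(1_A))y$ for $x,y\in\mathcal G$, $a\in A$. Set $\chi(x)=\rho(x)(1_A)$ and $\bar\rho(x)=\rho(x)-L_{\chi(x)}$; then $(\mathcal G,\bar\rho)$ is a Lie--Rinehart algebra (i.e. an LRJ algebra whose anchor takes values in derivations). For an LRJ algebra $(\mathcal G,\rho)$, $C^p_\rho(\mathcal G,A)=\mathrm{Alt}^p_A(\mathcal G,A)$ is the $A$-module of alternating $A$-multilinear maps $\mathcal G^p\to A$, with differential $(d_\rho\beta)(x_0,\dots,x_p)=\sum_i(-1)^i\rho(x_i)\beta(x_0,\dots,\widehat{x_i},\dots,x_p)+\sum_{i<j}(-1)^{i+j}\beta([x_i,x_j],x_0,\dots,\widehat{x_i},\dots,\widehat{x_j},\dots,x_p)$, so $(d_\rho a)(x)=\rho(x)(a)$ for $a\in A=C^0_\rho$. $d_{\bar\rho}$ is defined by the same formula with $\bar\rho$ in place of $\rho$. $i_x$ denotes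 interior product. A symplectic form on $(\mathcal G,\rho)$ is $\omega\in C^2_\rho(\mathcal G,A)$ with $d_\rho\omega=0$ and $\omega^\flat:\mathcal G\to\mathcal G^*=\mathrm{Hom}_A(\mathcal G,A)$, $x\mapsto i_x\omega$, an isomorphism of $A$-modules; $(\mathcal G,\rho,\omega)$ is then a symplectic LRJ algebra. The symplectic gradient $X_a\in\mathcal G$ of $a\in A$ is defined by $i_{X_a}\omega=d_\rho a$, and $\{a,b\}_\omega=-\omega(X_a,X_b)$ $(=\rho(X_a)(b))$; this is a Lie bracket making $A$ a Jacobi algebra, i.e. $\{a,bc\}=\{a,b\}c+b\{a,c\}-\{a,1_A\}bc$. For a symplectic form $\Omega$ on the Lie--Rinehart algebra $(\mathcal G,\bar\rho)$ the same definitions are used with $\bar\rho$: $i_{X^\Omega_a}\Omega=d_{\bar\rho}a$ and $\{a,b\}_\Omega=-\Omega(X^\Omega_a,X^\Omega_b)$, which is a Poisson bracket. *)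

theory Defs
  imports Complex_Main "HOL-Library.Function_Algebras"
begin

text \<open>
  The algebra \<open>A\<close> is the type \<open>'a\<close>, the module \<open>\<G>\<close> is the type \<open>'g\<close>; the actions of \<open>K\<close> on \<open>A\<close>
  and of \<open>A\<close> on \<open>\<G>\<close> are the explicit operations \<open>scaleK\<close> and \<open>smul\<close>.  The \<open>K\<close>-vector space
  structure of an \<open>A\<close>-module is the one induced along \<open>k \<mapsto> k 1\<^sub>A\<close>.
\<close>

locale comm_algebra = vector_space scaleK
  for scaleK :: "'k::field_char_0 \<Rightarrow> 'a::comm_ring_1 \<Rightarrow> 'a" +
  assumes scaleK_mult: "scaleK k (a * b) = scaleK k a * b"

locale lie_algebra = vector_space scale
  for scale :: "'k::field \<Rightarrow> 'v::ab_group_add \<Rightarrow> 'v" +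
  fixes bracket :: "'v \<Rightarrow> 'v \<Rightarrow> 'v"
  assumes bracket_add_left: "bracket (x + y) z = bracket x z + bracket y z"
    and bracket_add_right: "bracket x (y + z) = bracket x y + bracket x z"
    and bracket_scale_left: "bracket (scale k x) y = scale k (bracket x y)"
    and bracket_scale_right: "bracket x (scale k y) = scale k (bracket x y)"
    and bracket_self: "bracket x x = 0"
    and bracket_jacobi:
      "bracket x (bracket y z) + bracket y (bracket z x) + bracket z (bracket x y) = 0"

definition mult_op :: "'a::comm_ring_1 \<Rightarrow> 'a \<Rightarrow> 'a"
  where "mult_op a = (\<lambda>b. a * b)"

definition commutator :: "('a::comm_ring_1 \<Rightarrow> 'a) \<Rightarrow> ('a \<Rightarrow> 'a) \<Rightarrow> 'a \<Rightarrow> 'a"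
  where "commutator D E = (\<lambda>a. D (E a) - E (D a))"

definition diff1 :: "('k::field_char_0 \<Rightarrow> 'a::comm_ring_1 \<Rightarrow> 'a) \<Rightarrow> ('a \<Rightarrow> 'a) set"
  where "diff1 scaleK = {D. Vector_Spaces.linear scaleK scaleK D \<and>
    (\<forall>a b. commutator (commutator D (mult_op a)) (mult_op b) = 0)}"

definition derivations :: "('k::field_char_0 \<Rightarrow> 'a::comm_ring_1 \<Rightarrow> 'a) \<Rightarrow> ('a \<Rightarrow> 'a) set"
  where "derivations scaleK = {D. Vector_Spaces.linear scaleK scaleK D \<and>
    (\<forall>a b. D (a * b) = D a * b + a * D b)}"

locale lrj_algebra =
  A: comm_algebra scaleK +
  G: module smul +
  Lie: lie_algebra "\<lambda>k. smul (scaleK k 1)" bracket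
  for scaleK :: "'k::field_char_0 \<Rightarrow> 'a::comm_ring_1 \<Rightarrow> 'a"
    and smul :: "'a \<Rightarrow> 'g::ab_group_add \<Rightarrow> 'g"
    and bracket :: "'g \<Rightarrow> 'g \<Rightarrow> 'g" +
  fixes \<rho> :: "'g \<Rightarrow> 'a \<Rightarrow> 'a"
  assumes anchor_diff1: "\<rho> x \<in> diff1 scaleK"
    and anchor_add: "\<rho> (x + y) b = \<rho> x b + \<rho> y b"
    and anchor_smul: "\<rho> (smul a x) b = a * \<rho> x b"
    and anchor_bracket: "\<rho> (bracket x y) = commutator (\<rho> x) (\<rho> y)"
    and bracket_smul_right:
      "bracket x (smul a y) = smul a (bracket x y) + smul (\<rho> x a - a * \<rho> x 1) y"

locale lie_rinehart_algebra = lrj_algebra +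
  assumes anchor_derivation: "\<rho> x \<in> derivations scaleK"

definition chi :: "('g \<Rightarrow> 'a \<Rightarrow> 'a) \<Rightarrow> 'g \<Rightarrow> 'a::comm_ring_1"
  where "chi \<rho> x = \<rho> x 1"

definition rho_bar :: "('g \<Rightarrow> 'a \<Rightarrow> 'a) \<Rightarrow> 'g \<Rightarrow> 'a \<Rightarrow> 'a::comm_ring_1"
  where "rho_bar \<rho> x = (\<lambda>a. \<rho> x a - mult_op (chi \<rho> x) a)"

text \<open>
  A map \<open>\<G>\<^sup>p \<rightarrow> A\<close> is encoded as a function on lists over \<open>\<G>\<close> that is zero on every list whose length
  is not \<open>p\<close>, so that equality of cochains is equality of functions.  In particular \<open>a \<in> A = C\<^sup>0\<close> is
  the function \<open>cochain0 a\<close> supported on the empty list.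
\<close>

definition cochains ::
    "('a::comm_ring_1 \<Rightarrow> 'g::ab_group_add \<Rightarrow> 'g) \<Rightarrow> nat \<Rightarrow> ('g list \<Rightarrow> 'a) set"
  where "cochains smul p = {\<beta>.
    (\<forall>xs. length xs \<noteq> p \<longrightarrow> \<beta> xs = 0) \<and>
    (\<forall>xs i x y. length xs = p \<and> i < p \<longrightarrow>
       \<beta> (xs[i := x + y]) = \<beta> (xs[i := x]) + \<beta> (xs[i := y])) \<and>
    (\<forall>xs i a x. length xs = p \<and> i < p \<longrightarrow> \<beta> (xs[i := smul a x]) = a * \<beta> (xs[i := x])) \<and>
    (\<forall>xs i j. length xs = p \<and> i < j \<and> j < p \<and> xs ! i = xs ! j \<longrightarrow> \<beta> xs = 0)}"

definition cochain0 :: "'a::comm_ring_1 \<Rightarrow> 'g list \<Rightarrow> 'a"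
  where "cochain0 a = (\<lambda>xs. if xs = [] then a else 0)"

definition omit :: "nat \<Rightarrow> 'b list \<Rightarrow> 'b list"
  where "omit i xs = take i xs @ drop (Suc i) xs"

text \<open>
  For \<open>i < j\<close> the list \<open>omit i (omit j xs)\<close> lacks exactly the entries \<open>i\<close> and \<open>j\<close> of \<open>xs\<close>.  The degree
  of \<open>\<beta>\<close> need not be passed: a \<open>\<beta>\<close> supported on lists of length \<open>p\<close> is sent to one supported on
  lists of length \<open>p + 1\<close>.
\<close>

definition differential ::
    "('g \<Rightarrow> 'g \<Rightarrow> 'g) \<Rightarrow> ('g \<Rightarrow> 'a \<Rightarrow> 'a) \<Rightarrow> ('g list \<Rightarrow> 'a::comm_ring_1) \<Rightarrow> 'g list \<Rightarrow> 'a"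
  where "differential bracket \<rho> \<beta> = (\<lambda>xs.
    (\<Sum>i<length xs. (- 1) ^ i * \<rho> (xs ! i) (\<beta> (omit i xs))) +
    (\<Sum>j<length xs. \<Sum>i<j.
       (- 1) ^ (i + j) * \<beta> (bracket (xs ! i) (xs ! j) # omit i (omit j xs))))"

definition cochain_mult :: "'a::comm_ring_1 \<Rightarrow> ('g list \<Rightarrow> 'a) \<Rightarrow> 'g list \<Rightarrow> 'a"
  where "cochain_mult a \<beta> = (\<lambda>xs. a * \<beta> xs)"

definition cochain_scale ::
    "('k::field_char_0 \<Rightarrow> 'a::comm_ring_1 \<Rightarrow> 'a) \<Rightarrow> 'k \<Rightarrow> ('g list \<Rightarrow> 'a) \<Rightarrow> 'g list \<Rightarrow> 'a"
  where "cochain_scale scaleK k \<beta> = (\<lambda>xs. scaleK k (\<beta> xs))"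

definition interior_prod :: "'g \<Rightarrow> ('g list \<Rightarrow> 'a::comm_ring_1) \<Rightarrow> 'g list \<Rightarrow> 'a"
  where "interior_prod x \<beta> = (\<lambda>xs. \<beta> (x # xs))"

definition linear_on ::
    "('k::field \<Rightarrow> 'b::ab_group_add \<Rightarrow> 'b) \<Rightarrow> ('k \<Rightarrow> 'c::ab_group_add \<Rightarrow> 'c) \<Rightarrow> 'b set \<Rightarrow> ('b \<Rightarrow> 'c) \<Rightarrow> bool"
  where "linear_on s1 s2 S f \<longleftrightarrow>
    (\<forall>x\<in>S. \<forall>y\<in>S. f (x + y) = f x + f y) \<and> (\<forall>k. \<forall>x\<in>S. f (s1 k x) = s2 k (f x))"

definition cochain_complex ::
    "('k::field \<Rightarrow> 'b::ab_group_add \<Rightarrow> 'b) \<Rightarrow> (nat \<Rightarrow> 'b set) \<Rightarrow> ('b \<Rightarrow> 'b) \<Rightarrow> bool"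
  where "cochain_complex s C d \<longleftrightarrow>
    vector_space s \<and>
    (\<forall>p. module.subspace s (C p) \<and> linear_on s s (C p) d \<and>
      d ` C p \<subseteq> C (Suc p) \<and> (\<forall>\<beta>\<in>C p. d (d \<beta>) = 0))"

definition complex_isomorphism ::
    "('k::field \<Rightarrow> 'b::ab_group_add \<Rightarrow> 'b) \<Rightarrow> (nat \<Rightarrow> 'b set) \<Rightarrow> ('b \<Rightarrow> 'b) \<Rightarrow>
     ('k \<Rightarrow> 'c::ab_group_add \<Rightarrow> 'c) \<Rightarrow> (nat \<Rightarrow> 'c set) \<Rightarrow> ('c \<Rightarrow> 'c) \<Rightarrow> ('b \<Rightarrow> 'c) \<Rightarrow> bool"
  where "complex_isomorphism s C d s' C' d' f \<longleftrightarrow>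
    cochain_complex s C d \<and> cochain_complex s' C' d' \<and>
    (\<forall>p. linear_on s s' (C p) f \<and> bij_betw f (C p) (C' p) \<and>
      (\<forall>\<beta>\<in>C p. d' (f \<beta>) = f (d \<beta>)))"

definition module_dual :: "('a::comm_ring_1 \<Rightarrow> 'g::ab_group_add \<Rightarrow> 'g) \<Rightarrow> ('g \<Rightarrow> 'a) set"
  where "module_dual smul = {f. module_hom smul (*) f}"

definition flat :: "('g list \<Rightarrow> 'a::comm_ring_1) \<Rightarrow> 'g \<Rightarrow> 'g \<Rightarrow> 'a"
  where "flat \<omega> x = (\<lambda>y. interior_prod x \<omega> [y])"

definition symplectic_form ::
    "('a::comm_ring_1 \<Rightarrow> 'g::ab_group_add \<Rightarrow> 'g) \<Rightarrow> ('g \<Rightarrow> 'g \<Rightarrow> 'g) \<Rightarrow> ('g \<Rightarrow> 'a \<Rightarrow> 'a) \<Rightarrow>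
     ('g list \<Rightarrow> 'a) \<Rightarrow> bool"
  where "symplectic_form smul bracket \<rho> \<omega> \<longleftrightarrow>
    \<omega> \<in> cochains smul 2 \<and>
    differential bracket \<rho> \<omega> = 0 \<and>
    module_hom smul (\<lambda>a f y. a * f y) (flat \<omega>) \<and>
    bij_betw (flat \<omega>) UNIV (module_dual smul)"

locale symplectic_lrj_algebra = lrj_algebra scaleK smul bracket \<rho>
  for scaleK :: "'k::field_char_0 \<Rightarrow> 'a::comm_ring_1 \<Rightarrow> 'a"
    and smul :: "'a \<Rightarrow> 'g::ab_group_add \<Rightarrow> 'g"
    and bracket :: "'g \<Rightarrow> 'g \<Rightarrow> 'g"
    and \<rho> :: "'g \<Rightarrow> 'a \<Rightarrow> 'a" +
  fixes \<omega> :: "'g list \<Rightarrow> 'a"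
  assumes symplectic: "symplectic_form smul bracket \<rho> \<omega>"

definition sympl_gradient ::
    "('g \<Rightarrow> 'g \<Rightarrow> 'g) \<Rightarrow> ('g \<Rightarrow> 'a \<Rightarrow> 'a) \<Rightarrow> ('g list \<Rightarrow> 'a::comm_ring_1) \<Rightarrow> 'a \<Rightarrow> 'g"
  where "sympl_gradient bracket \<rho> \<omega> a =
    (THE x. interior_prod x \<omega> = differential bracket \<rho> (cochain0 a))"

definition sympl_bracket ::
    "('g \<Rightarrow> 'g \<Rightarrow> 'g) \<Rightarrow> ('g \<Rightarrow> 'a \<Rightarrow> 'a) \<Rightarrow> ('g list \<Rightarrow> 'a::comm_ring_1) \<Rightarrow> 'a \<Rightarrow> 'a \<Rightarrow> 'a"
  where "sympl_bracket bracket \<rho> \<omega> a b =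
    - \<omega> [sympl_gradient bracket \<rho> \<omega> a, sympl_gradient bracket \<rho> \<omega> b]"

locale jacobi_algebra = comm_algebra scaleK + lie_algebra scaleK br
  for scaleK :: "'k::field_char_0 \<Rightarrow> 'a::comm_ring_1 \<Rightarrow> 'a"
    and br :: "'a \<Rightarrow> 'a \<Rightarrow> 'a" +
  assumes br_mult: "br a (b * c) = br a b * c + b * br a c - br a 1 * b * c"

locale poisson_algebra = comm_algebra scaleK + lie_algebra scaleK br
  for scaleK :: "'k::field_char_0 \<Rightarrow> 'a::comm_ring_1 \<Rightarrow> 'a"
    and br :: "'a \<Rightarrow> 'a \<Rightarrow> 'a" +
  assumes br_leibniz: "br a (b * c) = br a b * c + b * br a c"

definition lie_isomorphism ::
    "('k::field \<Rightarrow> 'v::ab_group_add \<Rightarrow> 'v) \<Rightarrow> ('v \<Rightarrow> 'v \<Rightarrow> 'v) \<Rightarrow>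
     ('k \<Rightarrow> 'w::ab_group_add \<Rightarrow> 'w) \<Rightarrow> ('w \<Rightarrow> 'w \<Rightarrow> 'w) \<Rightarrow> ('v \<Rightarrow> 'w) \<Rightarrow> bool"
  where "lie_isomorphism s br s' br' f \<longleftrightarrow>
    lie_algebra s br \<and> lie_algebra s' br' \<and>
    Vector_Spaces.linear s s' f \<and> bij f \<and> (\<forall>x y. f (br x y) = br' (f x) (f y))"

end

theory Submission
  imports Defs
begin

text \<open>
  The conformal change itself is one computation.  Since \<open>\<chi>(x) = u\<^sup>-\<^sup>1 \<rho>'(x)(u)\<close> for the derivation
  \<open>\<rho>'(x) = \<rho>(x) - \<chi>(x)\<close>, the Leibniz rule gives \<open>\<rho>'(x)(u a) = u \<rho>(x)(a)\<close>: multiplication by \<open>u\<close>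
  intertwines the two anchors (\<open>rho_bar_unit_mult\<close>).  In the differential the anchor only acts on values
  of a cochain, and the bracket terms are \<open>A\<close>-linear in the cochain, so multiplication by \<open>u\<close> also
  intertwines the two differentials.  Hence \<open>u \<omega>\<close> is closed; the equations defining the two
  gradients, \<open>i\<^sub>x \<omega> = d a\<close> and \<open>i\<^sub>x (u \<omega>) = d' (u a)\<close>, differ by the factor \<open>u\<close> and have the same
  solution; and \<open>{a, b} = \<rho>(X\<^sub>a)(b)\<close> shows that multiplication by \<open>u\<close> carries one bracket to the other.

  The larger part is that the objects being compared are what they are called: that \<open>d\<close> maps
  \<open>C\<^sup>p\<close> to \<open>C\<^sup>p\<^sup>+\<^sup>1\<close> with \<open>d d = 0\<close>, and that the bracket of a symplectic form satisfies the Jacobi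
  identity.  Summing signs over multi-indices is avoided by a Cartan calculus.  A cochain of degree
  \<open>p + 1\<close> is the same as a map \<open>x \<mapsto> i\<^sub>x \<beta>\<close> into \<open>C\<^sup>p\<close> that is \<open>A\<close>-linear and satisfies \<open>i\<^sub>x i\<^sub>x \<beta> = 0\<close>
  (\<open>cochains_SucD\<close>, \<open>cochains_SucI\<close>), so statements about cochains can be proved by induction on the
  degree, contracting with one more argument at each step.  The relations that feed these inductions
  are \<open>i\<^sub>y L\<^sub>x = L\<^sub>x i\<^sub>y - i\<^bsub>[x,y]\<^esub>\<close> (\<open>interior_prod_lie_deriv\<close>) and \<open>i\<^sub>x d = L\<^sub>x - d i\<^sub>x\<close>
  (\<open>cartan_formula\<close>), where the second is the only place at which the explicit formula for \<open>d\<close> has to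
  be rearranged.  They yield in turn \<open>[L\<^sub>x, L\<^sub>y] = L\<^bsub>[x,y]\<^esub>\<close>, \<open>d L\<^sub>x = L\<^sub>x d\<close> and \<open>d d = 0\<close>.

  The Jacobi identity then follows from \<open>X\<^bsub>{a,b}\<^esub> = [X\<^sub>a, X\<^sub>b]\<close> (\<open>gradient_bracket\<close>) because \<open>\<rho>\<close> is a Lie
  algebra morphism.  The Poisson bracket is the special case of an anchor that kills \<open>1\<close>.
\<close>

section \<open>Cochains by recursion on the degree\<close>

lemma cochain_eqI:
  assumes "f [] = g []" and "\<And>x. interior_prod x f = interior_prod x g"
  shows "f = g"
proof
  fix xs show "f xs = g xs"
    using assms(1) fun_cong[OF assms(2)] by (cases xs) (auto simp: interior_prod_def)
qed

lemma interior_prod_add: "interior_prod x (f + g) = interior_prod x f + interior_prod x g"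
  and interior_prod_diff: "interior_prod x (f - g) = interior_prod x f - interior_prod x g"
  and interior_prod_zero: "interior_prod x 0 = 0"
  and interior_prod_mult:
    "interior_prod x (cochain_mult a f) = cochain_mult a (interior_prod x f)"
  by (auto simp: interior_prod_def cochain_mult_def fun_eq_iff)

lemmas interior_prod_simps =
  interior_prod_add interior_prod_diff interior_prod_zero interior_prod_mult

lemma cochain_mult_add: "cochain_mult a (f + g) = cochain_mult a f + cochain_mult a g"
  and cochain_mult_diff: "cochain_mult a (f - g) = cochain_mult a f - cochain_mult a g"
  and cochain_mult_uminus: "cochain_mult a (- f) = - cochain_mult a f"
  and cochain_mult_zero: "cochain_mult a 0 = 0"
  by (auto simp: cochain_mult_def fun_eq_iff algebra_simps)

lemma cochains_0_iff: "\<beta> \<in> cochains smul 0 \<longleftrightarrow> (\<forall>xs. xs \<noteq> [] \<longrightarrow> \<beta> xs = 0)"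
  by (auto simp: cochains_def)

lemma cochain0_in_cochains: "cochain0 a \<in> cochains smul 0"
  by (simp add: cochains_0_iff cochain0_def)

lemma interior_prod_cochains_0: "\<beta> \<in> cochains smul 0 \<Longrightarrow> interior_prod x \<beta> = 0"
  by (auto simp: cochains_0_iff interior_prod_def fun_eq_iff)

lemma cochains_add: "f \<in> cochains smul p \<Longrightarrow> g \<in> cochains smul p \<Longrightarrow> f + g \<in> cochains smul p"
  unfolding cochains_def by (auto simp: algebra_simps)

lemma cochains_mult: "f \<in> cochains smul p \<Longrightarrow> cochain_mult a f \<in> cochains smul p"
  unfolding cochains_def cochain_mult_def by (auto simp: algebra_simps)

lemma cochains_zero: "0 \<in> cochains smul p"
  unfolding cochains_def by auto

lemma cochains_diff:
  assumes "f \<in> cochains smul p" "g \<in> cochains smul p"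
  shows "f - g \<in> cochains smul p"
proof -
  have "f - g = f + cochain_mult (-1) g"
    by (auto simp: cochain_mult_def fun_eq_iff)
  then show ?thesis using assms by (simp only: cochains_add cochains_mult)
qed

text \<open>
  The three closure conditions on a cochain, read at the first argument, become equations
  between contractions; read at the later arguments, they say that the contraction is a cochain.
\<close>

lemma cochains_SucD:
  fixes smul :: "'a::comm_ring_1 \<Rightarrow> 'g::ab_group_add \<Rightarrow> 'g" and \<beta> :: "'g list \<Rightarrow> 'a"
  assumes "\<beta> \<in> cochains smul (Suc p)"
  shows "interior_prod x \<beta> \<in> cochains smul p"
    and "interior_prod (x + y) \<beta> = interior_prod x \<beta> + interior_prod y \<beta>"
    and "interior_prod (smul a x) \<beta> = cochain_mult a (interior_prod x \<beta>)"
    and "interior_prod x (interior_prod x \<beta>) = 0"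
proof -
  have supp: "\<And>xs. length xs \<noteq> Suc p \<Longrightarrow> \<beta> xs = 0"
    and add: "\<And>xs i x y. length xs = Suc p \<Longrightarrow> i < Suc p \<Longrightarrow>
       \<beta> (xs[i := x + y]) = \<beta> (xs[i := x]) + \<beta> (xs[i := y])"
    and lin: "\<And>xs i a x. length xs = Suc p \<Longrightarrow> i < Suc p \<Longrightarrow>
       \<beta> (xs[i := smul a x]) = a * \<beta> (xs[i := x])"
    and alt: "\<And>xs i j. length xs = Suc p \<Longrightarrow> i < j \<Longrightarrow> j < Suc p \<Longrightarrow> xs ! i = xs ! j \<Longrightarrow> \<beta> xs = 0"
    using assms unfolding cochains_def by blast+
  show "interior_prod x \<beta> \<in> cochains smul p"
    unfolding cochains_def interior_prod_def
  proof (intro CollectI conjI allI impI; (elim conjE)?)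
    fix xs :: "'g list"
    assume "length xs \<noteq> p"
    then show "\<beta> (x # xs) = 0" using supp by simp
  next
    fix xs :: "'g list" and i y z assume "length xs = p" "i < p"
    then show "\<beta> (x # xs[i := y + z]) = \<beta> (x # xs[i := y]) + \<beta> (x # xs[i := z])"
      using add[of "x # xs" "Suc i" y z] by simp
  next
    fix xs :: "'g list" and i a y assume "length xs = p" "i < p"
    then show "\<beta> (x # xs[i := smul a y]) = a * \<beta> (x # xs[i := y])"
      using lin[of "x # xs" "Suc i" a y] by simp
  next
    fix xs :: "'g list" and i j assume "length xs = p" "i < j" "j < p" "xs ! i = xs ! j"
    then show "\<beta> (x # xs) = 0"
      using alt[of "x # xs" "Suc i" "Suc j"] by simp
  qed
  show "interior_prod (x + y) \<beta> = interior_prod x \<beta> + interior_prod y \<beta>"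
  proof
    fix zs show "interior_prod (x + y) \<beta> zs = (interior_prod x \<beta> + interior_prod y \<beta>) zs"
      using add[of "x # zs" 0 x y] supp
      by (cases "length zs = p") (auto simp: interior_prod_def)
  qed
  show "interior_prod (smul a x) \<beta> = cochain_mult a (interior_prod x \<beta>)"
  proof
    fix zs show "interior_prod (smul a x) \<beta> zs = cochain_mult a (interior_prod x \<beta>) zs"
      using lin[of "x # zs" 0 a x] supp
      by (cases "length zs = p") (auto simp: interior_prod_def cochain_mult_def)
  qed
  show "interior_prod x (interior_prod x \<beta>) = 0"
  proof
    fix zs show "interior_prod x (interior_prod x \<beta>) zs = 0 zs"
      using alt[of "x # x # zs" 0 1] supp[of "x # x # zs"]
      by (cases "length zs + 1 = p") (auto simp: interior_prod_def)
  qed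
qed

lemma interior_prod_cochains:
  assumes "\<beta> \<in> cochains smul p"
  shows interior_prod_in_cochains: "interior_prod x \<beta> \<in> cochains smul (p - 1)"
    and interior_prod_plus: "interior_prod (x + y) \<beta> = interior_prod x \<beta> + interior_prod y \<beta>"
    and interior_prod_smul: "interior_prod (smul a x) \<beta> = cochain_mult a (interior_prod x \<beta>)"
    and interior_prod_self: "interior_prod x (interior_prod x \<beta>) = 0"
  using assms cochains_SucD[of \<beta> smul "p - 1"]
  by (cases p; simp add: interior_prod_cochains_0 interior_prod_simps cochain_mult_zero cochains_zero)+

text \<open>
  The usual polarisation of \<open>i\<^sub>x i\<^sub>x = 0\<close>.  In its first argument \<open>\<beta>\<close> is only required to be additive,
  because the rule has to be applied to \<open>d \<beta>\<close> in order to prove that it is \<open>A\<close>-linear there.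
\<close>

lemma interior_prod_swap:
  assumes ip: "\<And>x. interior_prod x \<beta> \<in> cochains smul p"
    and add: "\<And>x y. interior_prod (x + y) \<beta> = interior_prod x \<beta> + interior_prod y \<beta>"
    and alt: "\<And>x. interior_prod x (interior_prod x \<beta>) = 0"
  shows "interior_prod x (interior_prod y \<beta>) = - interior_prod y (interior_prod x \<beta>)"
proof -
  have "interior_prod x (interior_prod y \<beta>) + interior_prod y (interior_prod x \<beta>) =
      interior_prod (x + y) (interior_prod (x + y) \<beta>)"
    by (simp add: add interior_prod_simps interior_prod_plus[OF ip] alt)
  also have "\<dots> = 0" by (rule alt)
  finally show ?thesis by (simp add: add_eq_0_iff2)
qed

lemma cochains_swap:
  assumes "\<beta> \<in> cochains smul p"
  shows "interior_prod x (interior_prod y \<beta>) = - interior_prod y (interior_prod x \<beta>)"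
  by (rule interior_prod_swap[OF interior_prod_in_cochains[OF assms]])
    (simp_all add: interior_prod_plus[OF assms] interior_prod_self[OF assms])

text \<open>
  Converse of the preceding description of \<open>C\<^sup>p\<^sup>+\<^sup>1\<close>.  Only equal arguments in the first two places are
  assumed to give zero; when the first argument recurs further down the list, antisymmetry moves it
  into the second place, past an argument with which the contraction is already alternating.
\<close>

lemma cochains_SucI:
  fixes smul :: "'a::comm_ring_1 \<Rightarrow> 'g::ab_group_add \<Rightarrow> 'g" and \<beta> :: "'g list \<Rightarrow> 'a"
  assumes nil: "\<beta> [] = 0"
    and ip: "\<And>x. interior_prod x \<beta> \<in> cochains smul p"
    and add: "\<And>x y. interior_prod (x + y) \<beta> = interior_prod x \<beta> + interior_prod y \<beta>"
    and lin: "\<And>a x. interior_prod (smul a x) \<beta> = cochain_mult a (interior_prod x \<beta>)"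
    and alt: "\<And>x. interior_prod x (interior_prod x \<beta>) = 0"
  shows "\<beta> \<in> cochains smul (Suc p)"
proof -
  have ip': "(\<forall>xs. length xs \<noteq> p \<longrightarrow> \<beta> (x # xs) = 0) \<and>
    (\<forall>xs i y z. length xs = p \<and> i < p \<longrightarrow>
       \<beta> (x # xs[i := y + z]) = \<beta> (x # xs[i := y]) + \<beta> (x # xs[i := z])) \<and>
    (\<forall>xs i a y. length xs = p \<and> i < p \<longrightarrow>
       \<beta> (x # xs[i := smul a y]) = a * \<beta> (x # xs[i := y])) \<and>
    (\<forall>xs i j. length xs = p \<and> i < j \<and> j < p \<and> xs ! i = xs ! j \<longrightarrow> \<beta> (x # xs) = 0)" for x
    using ip[of x] unfolding cochains_def interior_prod_def by blast
  have add': "\<beta> ((x + y) # xs) = \<beta> (x # xs) + \<beta> (y # xs)"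
    and lin': "\<beta> (smul a x # xs) = a * \<beta> (x # xs)"
    and alt': "\<beta> (x # x # xs) = 0"
    and swap': "\<beta> (x # y # xs) = - \<beta> (y # x # xs)" for x y a xs
    using fun_cong[OF add[of x y], of xs] fun_cong[OF lin[of a x], of xs]
      fun_cong[OF alt[of x], of xs] fun_cong[OF interior_prod_swap[OF ip add alt, of y x], of xs]
    by (simp_all add: interior_prod_def cochain_mult_def)
  show ?thesis
    unfolding cochains_def
  proof (intro CollectI conjI allI impI; (elim conjE)?)
    fix xs :: "'g list"
    assume "length xs \<noteq> Suc p"
    then show "\<beta> xs = 0" using nil ip' by (cases xs) auto
  next
    fix xs :: "'g list" and i y z assume "length xs = Suc p" "i < Suc p"
    then show "\<beta> (xs[i := y + z]) = \<beta> (xs[i := y]) + \<beta> (xs[i := z])"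
      using ip' add' by (cases xs; cases i) auto
  next
    fix xs :: "'g list" and i a y assume "length xs = Suc p" "i < Suc p"
    then show "\<beta> (xs[i := smul a y]) = a * \<beta> (xs[i := y])"
      using ip' lin' by (cases xs; cases i) auto
  next
    fix xs :: "'g list" and i j assume *: "length xs = Suc p" "i < j" "j < Suc p" "xs ! i = xs ! j"
    then obtain x ys j' where xs: "xs = x # ys" and j: "j = Suc j'"
      by (cases xs; cases j) auto
    show "\<beta> xs = 0"
    proof (cases i)
      case (Suc i')
      then show ?thesis
        using * ip'[of x] by (auto simp only: xs j Suc nth_Cons_Suc length_Cons Suc_less_eq nat.inject)
    next
      case 0
      then obtain y zs where ys: "ys = y # zs" using * by (cases ys) (auto simp: xs j)
      show ?thesis
      proof (cases j')
        case 0
        then show ?thesis using * \<open>i = 0\<close> alt' by (simp add: xs j ys)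
      next
        case (Suc j'')
        have "length (x # zs) = p \<and> 0 < j' \<and> j' < p \<and> (x # zs) ! 0 = (x # zs) ! j'"
          using * \<open>i = 0\<close> by (simp add: xs j ys Suc)
        then have "\<beta> (y # x # zs) = 0" using ip' by blast
        then show ?thesis by (simp add: xs ys swap'[of x])
      qed
    qed
  qed
qed

text \<open>
  Moving an argument past the \<open>j\<close> arguments before it costs \<open>j\<close> transpositions.  This translates
  the bracket terms of the differential, in which the bracket comes first, into those of the Lie
  derivative, in which it stays in place.
\<close>

lemma cochain_move_to_front:
  assumes "\<beta> \<in> cochains smul p" and "j < length ys"
  shows "\<beta> (v # omit j ys) = (- 1) ^ j * \<beta> (ys[j := v])"
  using assms
proof (induction j arbitrary: \<beta> p ys)
  case 0
  then show ?case by (cases ys) (auto simp: omit_def)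
next
  case (Suc j)
  then obtain y zs where ys: "ys = y # zs" by (cases ys) auto
  have "\<beta> (v # y # omit j zs) = - interior_prod y \<beta> (v # omit j zs)"
    using fun_cong[OF cochains_swap[OF Suc.prems(1), of y v], of "omit j zs"]
    by (simp add: interior_prod_def)
  also have "\<dots> = (- 1) ^ Suc j * \<beta> (y # zs[j := v])"
    using Suc.IH[OF interior_prod_in_cochains[OF Suc.prems(1)], of zs y] Suc.prems(2)
    by (simp add: ys interior_prod_def)
  finally show ?case by (simp add: ys omit_def)
qed

section \<open>Cartan calculus\<close>

definition lie_deriv ::
    "('g \<Rightarrow> 'g \<Rightarrow> 'g) \<Rightarrow> ('g \<Rightarrow> 'a \<Rightarrow> 'a) \<Rightarrow> 'g \<Rightarrow> ('g list \<Rightarrow> 'a::comm_ring_1) \<Rightarrow> 'g list \<Rightarrow> 'a"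
  where "lie_deriv bracket \<rho> x \<beta> =
    (\<lambda>ys. \<rho> x (\<beta> ys) - (\<Sum>j<length ys. \<beta> (ys[j := bracket x (ys ! j)])))"

context lie_algebra
begin

lemma bracket_skew: "bracket x y = - bracket y x"
proof -
  have "bracket x y + bracket y x = bracket (x + y) (x + y)"
    by (simp only: bracket_add_left bracket_add_right) (simp add: bracket_self)
  then show ?thesis by (simp add: bracket_self add_eq_0_iff2)
qed

lemma bracket_minus_right: "bracket x (- y) = - bracket x y"
proof -
  have "bracket x 0 = 0" using bracket_add_right[of x 0 0] by simp
  then show ?thesis
    using bracket_add_right[of x y "- y"] by (simp add: minus_unique)
qed

lemma bracket_bracket: "bracket x (bracket y z) - bracket y (bracket x z) = bracket (bracket x y) z"
proof -
  have "bracket x (bracket y z) + - bracket y (bracket x z) + - bracket (bracket x y) z = 0"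
    using bracket_jacobi[of x y z]
    unfolding bracket_skew[of z x] bracket_skew[of z "bracket x y"] bracket_minus_right .
  then show ?thesis by simp
qed

end

lemma diff1_linear: "D \<in> diff1 scaleK \<Longrightarrow> Vector_Spaces.linear scaleK scaleK D"
  by (simp add: diff1_def)

lemma diff1_mult:
  assumes "D \<in> diff1 scaleK"
  shows "D (a * b) = a * D b + D a * b - a * b * D 1"
proof -
  have "commutator (commutator D (mult_op a)) (mult_op b) 1 = 0"
    using assms by (simp add: diff1_def)
  then show ?thesis by (simp add: commutator_def mult_op_def algebra_simps)
qed

context lrj_algebra
begin

abbreviation "d \<equiv> differential bracket \<rho>"
abbreviation "L \<equiv> lie_deriv bracket \<rho>"
abbreviation "\<iota> \<equiv> interior_prod"
abbreviation "C \<equiv> cochains smul"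

lemma anchor_plus: "\<rho> x (a + b) = \<rho> x a + \<rho> x b"
  and anchor_scale: "\<rho> x (scaleK k b) = scaleK k (\<rho> x b)"
  using diff1_linear[OF anchor_diff1[of x]]
  by (simp_all add: Vector_Spaces.linear_iff)

lemma anchor_zero: "\<rho> x 0 = 0"
  using anchor_plus[of x 0 0] by simp

lemma anchor_minus: "\<rho> x (- a) = - \<rho> x a"
  using anchor_plus[of x a "- a"] by (simp add: anchor_zero minus_unique)

lemma anchor_diff: "\<rho> x (a - b) = \<rho> x a - \<rho> x b"
  using anchor_plus[of x a "- b"] by (simp add: anchor_minus)

lemma anchor_mult: "\<rho> x (a * b) = a * \<rho> x b + (\<rho> x a - a * \<rho> x 1) * b"
  using diff1_mult[OF anchor_diff1[of x], of a b] by (simp add: algebra_simps)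

lemma differential_diff: "d (f - g) = d f - d g"
  and differential_add: "d (f + g) = d f + d g"
  by (auto simp: differential_def fun_eq_iff anchor_diff anchor_plus algebra_simps
     sum.distrib sum_subtractf)

lemma differential_zero: "d 0 = 0"
  by (auto simp: differential_def fun_eq_iff anchor_zero)

lemma scaleK_eq: "scaleK k b = scaleK k 1 * b"
  using A.scaleK_mult[of k 1 b] by simp

lemma cochain_scale_eq: "cochain_scale scaleK k = cochain_mult (scaleK k 1)"
  unfolding cochain_scale_def cochain_mult_def by (intro ext scaleK_eq)

lemma differential_scale:
  "d (cochain_scale scaleK k f) = cochain_scale scaleK k (d f)"
proof -
  have c: "\<rho> x (scaleK k 1 * b) = scaleK k 1 * \<rho> x b" for x b
    using anchor_scale[of x k b] scaleK_eq[of k b] scaleK_eq[of k "\<rho> x b"] by simp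
  show ?thesis unfolding cochain_scale_eq
    by (auto simp: differential_def fun_eq_iff cochain_mult_def c sum_distrib_left algebra_simps)
qed

lemma lie_deriv_diff: "L x (f - g) = L x f - L x g"
  and lie_deriv_add: "L x (f + g) = L x f + L x g"
  and lie_deriv_zero: "L x 0 = 0"
  by (auto simp: lie_deriv_def fun_eq_iff anchor_diff anchor_plus anchor_zero algebra_simps
     sum.distrib sum_subtractf)

lemma lie_deriv_mult:
  "L x (cochain_mult a f) = cochain_mult a (L x f) + cochain_mult (\<rho> x a - a * \<rho> x 1) f"
  by (auto simp: lie_deriv_def cochain_mult_def fun_eq_iff anchor_mult sum_distrib_left
     algebra_simps)

text \<open>
  The two terms on the right separate the summand of the Lie derivative that acts on the first
  argument \<open>y\<close> from those that act on the rest; \<open>f\<close> can be any function of lists.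
\<close>

lemma interior_prod_lie_deriv: "\<iota> y (L x f) = L x (\<iota> y f) - \<iota> (bracket x y) f"
  unfolding lie_deriv_def interior_prod_def
  by (auto simp: fun_eq_iff lessThan_Suc_eq_insert_0 sum.reindex)

lemma lie_deriv_cochains_0: "\<beta> \<in> C 0 \<Longrightarrow> L x \<beta> ys = \<rho> x (\<beta> ys)"
  by (cases "ys = []") (simp_all add: cochains_0_iff lie_deriv_def)

text \<open>
  Although \<open>\<rho>(x)\<close> and \<open>[x, -]\<close> are not \<open>A\<close>-linear, their defects \<open>\<rho>(x)(a) - a \<chi>(x)\<close> agree and
  cancel, so the Lie derivative of an \<open>A\<close>-multilinear map is again \<open>A\<close>-multilinear.
\<close>

lemma lie_deriv_cochains: "\<beta> \<in> C p \<Longrightarrow> L x \<beta> \<in> C p"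
proof (induction p arbitrary: \<beta>)
  case 0
  then show ?case by (auto simp: cochains_0_iff lie_deriv_def anchor_zero)
next
  case (Suc p)
  note ip = cochains_SucD[OF Suc.prems]
  show ?case
  proof (rule cochains_SucI)
    show "L x \<beta> [] = 0"
      using Suc.prems by (auto simp: lie_deriv_def cochains_def anchor_zero)
    show "\<iota> y (L x \<beta>) \<in> C p" for y
      unfolding interior_prod_lie_deriv by (intro cochains_diff Suc.IH ip)
    show "\<iota> (y + z) (L x \<beta>) = \<iota> y (L x \<beta>) + \<iota> z (L x \<beta>)" for y z
      by (simp add: interior_prod_lie_deriv Lie.bracket_add_right ip lie_deriv_add)
    show "\<iota> (smul a y) (L x \<beta>) = cochain_mult a (\<iota> y (L x \<beta>))" for a y
      by (simp add: interior_prod_lie_deriv bracket_smul_right ip lie_deriv_mult cochain_mult_diff)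
    show "\<iota> y (\<iota> y (L x \<beta>)) = 0" for y
      using cochains_swap[OF Suc.prems, of "bracket x y" y]
      by (simp add: interior_prod_lie_deriv interior_prod_simps ip lie_deriv_zero)
  qed
qed

lemma lie_deriv_plus: "\<beta> \<in> C p \<Longrightarrow> L (x + y) \<beta> = L x \<beta> + L y \<beta>"
proof (induction p arbitrary: \<beta>)
  case 0
  then show ?case by (simp add: lie_deriv_cochains_0 anchor_add fun_eq_iff)
next
  case (Suc p)
  show ?case
  proof (rule cochain_eqI)
    show "L (x + y) \<beta> [] = (L x \<beta> + L y \<beta>) []"
      by (simp add: lie_deriv_def anchor_add)
    show "\<iota> z (L (x + y) \<beta>) = \<iota> z (L x \<beta> + L y \<beta>)" for z
      by (simp add: interior_prod_simps interior_prod_lie_deriv Lie.bracket_add_left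
          Suc.IH cochains_SucD[OF Suc.prems] fun_eq_iff)
  qed
qed

text \<open>
  Contracting the commutator with \<open>z\<close>, the mixed terms cancel and the Jacobi identity turns
  \<open>[x, [y, z]] - [y, [x, z]]\<close> into \<open>[[x, y], z]\<close>, which is what contracting the right-hand side gives.
\<close>

lemma lie_deriv_bracket:
  "\<beta> \<in> C p \<Longrightarrow> L x (L y \<beta>) - L y (L x \<beta>) = L (bracket x y) \<beta>"
proof (induction p arbitrary: \<beta>)
  case 0
  show ?case
    \<comment> \<open>The outer derivatives must be evaluated first: evaluating the inner ones hides that their results
      are cochains.\<close>
    by (rule ext, simp only: fun_diff_def lie_deriv_cochains_0[OF lie_deriv_cochains[OF 0]])
      (simp only: lie_deriv_cochains_0[OF 0] anchor_bracket commutator_def)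
next
  case (Suc p)
  note ip = cochains_SucD[OF Suc.prems]
  have neg: "\<iota> (x - y) \<beta> = \<iota> x \<beta> - \<iota> y \<beta>" for x y
    using ip(2)[of "x - y" y] by (simp add: algebra_simps)
  show ?case
  proof (rule cochain_eqI)
    show "(L x (L y \<beta>) - L y (L x \<beta>)) [] = L (bracket x y) \<beta> []"
      by (simp add: lie_deriv_def anchor_bracket commutator_def)
  next
    fix z
    have "\<iota> z (L x (L y \<beta>) - L y (L x \<beta>)) = (L x (L y (\<iota> z \<beta>)) - L y (L x (\<iota> z \<beta>)))
       - (\<iota> (bracket x (bracket y z)) \<beta> - \<iota> (bracket y (bracket x z)) \<beta>)"
      by (simp add: interior_prod_lie_deriv interior_prod_simps lie_deriv_diff algebra_simps)
    also have "\<dots> = \<iota> z (L (bracket x y) \<beta>)"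
      unfolding interior_prod_lie_deriv Suc.IH[OF ip(1)] neg[symmetric] Lie.bracket_bracket ..
    finally show "\<iota> z (L x (L y \<beta>) - L y (L x \<beta>)) = \<iota> z (L (bracket x y) \<beta>)" .
  qed
qed

text \<open>
  The terms of \<open>d \<beta>\<close> on \<open>x # ys\<close> that involve \<open>x\<close> in the anchor or in the bracket form the Lie
  derivative, after the bracket has been moved back into its place; the others form the
  differential of the contraction, with a sign from the shift of the indices by one in the
  anchor terms and from exchanging \<open>x\<close> with the bracket in the others.
\<close>

lemma cartan_formula:
  assumes "\<beta> \<in> C p"
  shows "\<iota> x (d \<beta>) = L x \<beta> - d (\<iota> x \<beta>)"
proof
  fix ys :: "'g list"
  let ?n = "length ys"
  have omit: "omit 0 (x # zs) = zs" "omit (Suc i) (x # zs) = x # omit i zs" for i zs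
    by (simp_all add: omit_def)
  have move: "(- 1) ^ j * \<beta> (bracket x (ys ! j) # omit j ys) = \<beta> (ys[j := bracket x (ys ! j)])"
    if "j < ?n" for j
    using cochain_move_to_front[OF assms that] by (simp add: mult.assoc[symmetric] flip: power_mult_distrib)
  have swap: "\<beta> (v # x # zs) = - \<beta> (x # v # zs)" for v zs
    using fun_cong[OF cochains_swap[OF assms, of x v], of zs] by (simp add: interior_prod_def)
  have "d \<beta> (x # ys) = \<rho> x (\<beta> ys)
      - (\<Sum>i<?n. (- 1) ^ i * \<rho> (ys ! i) (\<beta> (x # omit i ys)))
      + (\<Sum>j<?n. - ((- 1) ^ j * \<beta> (bracket x (ys ! j) # omit j ys))
          + (\<Sum>i<j. (- 1) ^ (i + j) * \<beta> (bracket (ys ! i) (ys ! j) # x # omit i (omit j ys))))"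
    unfolding differential_def
    by (simp add: sum.lessThan_Suc_shift omit sum_negf del: sum.lessThan_Suc)
  also have "\<dots> = L x \<beta> ys - d (\<iota> x \<beta>) ys"
    unfolding differential_def lie_deriv_def interior_prod_def
    by (simp add: sum_subtractf sum_negf move swap)
  finally show "\<iota> x (d \<beta>) ys = (L x \<beta> - d (\<iota> x \<beta>)) ys"
    by (simp add: interior_prod_def)
qed

lemma differential_Nil: "d \<beta> [] = 0"
  by (simp add: differential_def)

text \<open>
  The induction uses the Cartan formula for everything but \<open>A\<close>-linearity in the first argument,
  where neither \<open>L\<^bsub>ax\<^esub> = a L\<^sub>x\<close> nor \<open>d a = a d\<close> holds.  Instead antisymmetry turns the first
  argument into the second one, that is, the first argument of \<open>i\<^sub>y (d \<beta>)\<close>, which is a cochain by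
  induction.
\<close>

lemma differential_cochains: "\<beta> \<in> C p \<Longrightarrow> d \<beta> \<in> C (Suc p)"
proof (induction p arbitrary: \<beta>)
  case 0
  have c: "\<iota> x (d \<beta>) = L x \<beta>" for x
    using 0 by (simp add: cartan_formula interior_prod_cochains_0 differential_zero)
  have "L (x + y) \<beta> = L x \<beta> + L y \<beta>" and "L (smul a x) \<beta> = cochain_mult a (L x \<beta>)" for x y a
    using 0 by (simp_all add: lie_deriv_cochains_0 fun_eq_iff anchor_add anchor_smul cochain_mult_def)
  then show ?case
    using 0 by (intro cochains_SucI)
      (simp_all add: differential_Nil c lie_deriv_cochains
        interior_prod_cochains_0[OF lie_deriv_cochains[OF 0]])
next
  case (Suc p)
  note ip = cochains_SucD[OF Suc.prems]
  note cartan = cartan_formula[OF Suc.prems] cartan_formula[OF ip(1)]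
  have ip1: "\<iota> x (d \<beta>) \<in> C (Suc p)" for x
    unfolding cartan by (intro cochains_diff lie_deriv_cochains Suc.IH Suc.prems ip)
  have alt: "\<iota> x (\<iota> x (d \<beta>)) = 0" for x
  proof -
    have "\<iota> x (\<iota> x (d \<beta>)) = d (\<iota> x (\<iota> x \<beta>)) - \<iota> (bracket x x) \<beta>"
      by (simp add: cartan interior_prod_simps interior_prod_lie_deriv)
    also have "\<dots> = 0"
      using ip(2)[of 0 0] by (simp add: ip Lie.bracket_self differential_zero)
    finally show ?thesis .
  qed
  have add: "\<iota> (x + y) (d \<beta>) = \<iota> x (d \<beta>) + \<iota> y (d \<beta>)" for x y
  proof -
    show ?thesis by (simp add: cartan ip differential_add lie_deriv_plus[OF Suc.prems])
  qed
  have swap: "\<iota> x (\<iota> y (d \<beta>)) = - \<iota> y (\<iota> x (d \<beta>))" for x y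
    by (rule interior_prod_swap[OF ip1 add alt])
  have lin: "\<iota> (smul a x) (d \<beta>) = cochain_mult a (\<iota> x (d \<beta>))" for a x
  proof (rule cochain_eqI)
    show "\<iota> (smul a x) (d \<beta>) [] = cochain_mult a (\<iota> x (d \<beta>)) []"
      using Suc.prems by (simp add: differential_def omit_def interior_prod_def cochain_mult_def anchor_smul)
  next
    fix y
    have "\<iota> y (\<iota> (smul a x) (d \<beta>)) = - \<iota> (smul a x) (\<iota> y (d \<beta>))" by (rule swap)
    also have "\<dots> = cochain_mult a (- \<iota> x (\<iota> y (d \<beta>)))"
      by (simp add: interior_prod_smul[OF ip1] cochain_mult_uminus)
    also have "\<dots> = \<iota> y (cochain_mult a (\<iota> x (d \<beta>)))"
      by (simp add: swap[of x y] interior_prod_simps)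
    finally show "\<iota> y (\<iota> (smul a x) (d \<beta>)) = \<iota> y (cochain_mult a (\<iota> x (d \<beta>)))" .
  qed
  show ?case by (rule cochains_SucI[OF differential_Nil ip1 add lin alt])
qed

text \<open>
  After contraction with \<open>y\<close> both sides expand by the Cartan formula; they differ by
  \<open>[L\<^sub>x, L\<^sub>y] - L\<^bsub>[x,y]\<^esub>\<close> and by the same statement for \<open>i\<^sub>y \<beta>\<close>.
\<close>

lemma differential_lie_deriv: "\<beta> \<in> C p \<Longrightarrow> d (L x \<beta>) = L x (d \<beta>)"
proof (induction p arbitrary: \<beta>)
  case 0
  show ?case
  proof (rule cochain_eqI)
    show "d (L x \<beta>) [] = L x (d \<beta>) []"
      by (simp add: differential_Nil lie_deriv_def anchor_zero)
    show "\<iota> y (d (L x \<beta>)) = \<iota> y (L x (d \<beta>))" for y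
      using lie_deriv_bracket[OF 0, of x y]
      by (simp add: cartan_formula[OF 0] cartan_formula[OF lie_deriv_cochains[OF 0]]
          interior_prod_lie_deriv interior_prod_cochains_0[OF 0]
          interior_prod_cochains_0[OF lie_deriv_cochains[OF 0]] lie_deriv_zero differential_zero
          algebra_simps)
  qed
next
  case (Suc p)
  note ip = cochains_SucD[OF Suc.prems]
  show ?case
  proof (rule cochain_eqI)
    show "d (L x \<beta>) [] = L x (d \<beta>) []"
      by (simp add: differential_Nil lie_deriv_def anchor_zero)
    show "\<iota> y (d (L x \<beta>)) = \<iota> y (L x (d \<beta>))" for y
      using lie_deriv_bracket[OF Suc.prems, of x y]
      by (simp add: cartan_formula[OF Suc.prems] cartan_formula[OF lie_deriv_cochains[OF Suc.prems]]
          interior_prod_lie_deriv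
        differential_diff lie_deriv_diff Suc.IH[OF ip(1)] algebra_simps)
  qed
qed

text \<open>
  By the Cartan formula \<open>i\<^sub>x d d = L\<^sub>x d - d i\<^sub>x d = L\<^sub>x d - d L\<^sub>x + d d i\<^sub>x\<close>, which reduces the claim to
  one degree less.
\<close>

lemma differential_differential: "\<beta> \<in> C p \<Longrightarrow> d (d \<beta>) = 0"
proof (induction p arbitrary: \<beta>)
  have step: "d (d \<beta>) = 0" if \<beta>: "\<beta> \<in> C p" and IH: "\<And>x. d (d (\<iota> x \<beta>)) = 0" for \<beta> p
  proof (rule cochain_eqI)
    show "d (d \<beta>) [] = 0 []" by (simp add: differential_Nil)
    fix x
    have "\<iota> x (d (d \<beta>)) = L x (d \<beta>) - (d (L x \<beta>) - d (d (\<iota> x \<beta>)))"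
      unfolding cartan_formula[OF differential_cochains[OF \<beta>]] cartan_formula[OF \<beta>]
        differential_diff ..
    then show "\<iota> x (d (d \<beta>)) = \<iota> x 0"
      unfolding differential_lie_deriv[OF \<beta>] IH interior_prod_zero by simp
  qed
  {
    case 0
    show ?case
      by (rule step[OF 0]) (simp only: interior_prod_cochains_0[OF 0] differential_zero)
  next
    case (Suc p)
    show ?case by (rule step[OF Suc.prems]) (rule Suc.IH[OF cochains_SucD(1)[OF Suc.prems]])
  }
qed

lemma cochain_complex_differential: "cochain_complex (cochain_scale scaleK) C d"
proof -
  have vs: "vector_space (cochain_scale scaleK :: 'k \<Rightarrow> ('g list \<Rightarrow> 'a) \<Rightarrow> 'g list \<Rightarrow> 'a)"
    by unfold_locales (simp_all add: cochain_scale_def fun_eq_iff A.scale_right_distrib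
        A.scale_left_distrib)
  interpret V: vector_space "cochain_scale scaleK :: 'k \<Rightarrow> ('g list \<Rightarrow> 'a) \<Rightarrow> 'g list \<Rightarrow> 'a"
    by (rule vs)
  have "V.subspace (C p)" for p
    unfolding V.subspace_def
    by (intro conjI ballI allI) (simp_all add: cochains_zero cochains_add cochain_scale_eq
       cochains_mult)
  then show ?thesis
    unfolding cochain_complex_def linear_on_def
    by (auto simp: vs differential_add differential_scale differential_cochains
        differential_differential)
qed

end

section \<open>The associated Lie-Rinehart algebra\<close>

lemma derivations_subset_diff1: "derivations scaleK \<subseteq> diff1 scaleK"
  by (auto simp: derivations_def diff1_def commutator_def mult_op_def fun_eq_iff algebra_simps)

context lrj_algebra
begin

lemma rho_bar_eq: "rho_bar \<rho> x a = \<rho> x a - \<rho> x 1 * a"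
  by (simp add: rho_bar_def chi_def mult_op_def)

lemma rho_bar_mult: "rho_bar \<rho> x (a * b) = rho_bar \<rho> x a * b + a * rho_bar \<rho> x b"
  by (simp add: rho_bar_eq anchor_mult algebra_simps)

lemma rho_bar_derivation: "rho_bar \<rho> x \<in> derivations scaleK"
proof -
  have "a * scaleK k b = scaleK k (a * b)" for a k b
    using A.scaleK_mult[of k b a] by (simp add: mult.commute)
  then have "Vector_Spaces.linear scaleK scaleK (rho_bar \<rho> x)"
    by (simp add: Vector_Spaces.linear_iff A.vector_space_axioms rho_bar_eq anchor_plus anchor_scale
        A.scale_right_diff_distrib algebra_simps)
  then show ?thesis by (simp add: derivations_def rho_bar_mult)
qed

lemma rho_bar_bracket: "rho_bar \<rho> (bracket x y) = commutator (rho_bar \<rho> x) (rho_bar \<rho> y)"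
  by (rule ext) (simp add: rho_bar_eq anchor_bracket commutator_def anchor_diff
     anchor_mult algebra_simps)

text \<open>
  The Leibniz rule for the bracket of \<open>\<G>\<close> involves \<open>\<rho>\<close> only through \<open>\<rho>(x)(a) - a \<chi>(x)\<close>, which is the
  derivation part, so it is unchanged when the anchor is replaced.
\<close>

lemma lie_rinehart_rho_bar: "lie_rinehart_algebra scaleK smul bracket (rho_bar \<rho>)"
proof unfold_locales
  show "rho_bar \<rho> x \<in> derivations scaleK" and "rho_bar \<rho> x \<in> diff1 scaleK" for x
    using rho_bar_derivation derivations_subset_diff1 by blast+
  show "rho_bar \<rho> (bracket x y) = commutator (rho_bar \<rho> x) (rho_bar \<rho> y)" for x y
    by (rule rho_bar_bracket)
  show "bracket x (smul a y) =
      smul a (bracket x y) + smul (rho_bar \<rho> x a - a * rho_bar \<rho> x 1) y" for x a y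
    by (simp add: bracket_smul_right rho_bar_eq algebra_simps)
qed (simp_all add: rho_bar_eq anchor_add anchor_smul algebra_simps)

end

section \<open>The Jacobi bracket of a symplectic form\<close>

lemma cochains_1_eqI:
  assumes "f \<in> cochains smul 1" "g \<in> cochains smul 1" and "\<And>y. f [y] = g [y]"
  shows "f = g"
proof
  fix xs
  show "f xs = g xs"
  proof (cases "length xs = 1")
    case True
    then show ?thesis using assms(3) by (auto simp: length_Suc_conv)
  next
    case False
    then show ?thesis using assms(1,2) by (simp add: cochains_def)
  qed
qed

lemma cochain0_add: "cochain0 (a + b) = cochain0 a + cochain0 b"
  and cochain0_mult: "cochain0 (a * b) = cochain_mult a (cochain0 b)"
  by (auto simp: cochain0_def cochain_mult_def fun_eq_iff)

context symplectic_lrj_algebra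
begin

abbreviation "X \<equiv> sympl_gradient bracket \<rho> \<omega>"
abbreviation "br \<equiv> sympl_bracket bracket \<rho> \<omega>"

lemma \<omega>_cochain: "\<omega> \<in> C 2"
  and \<omega>_closed: "d \<omega> = 0"
  and flat_hom: "module_hom smul (\<lambda>a f y. a * f y) (flat \<omega>)"
  and flat_bij: "bij_betw (flat \<omega>) UNIV (module_dual smul)"
  using symplectic by (auto simp: symplectic_form_def)

lemma differential_cochain0: "d (cochain0 a) [y] = \<rho> y a"
  by (simp add: differential_def omit_def cochain0_def)

text \<open>
  The defining equation of the gradient, an equality of functions on lists, becomes an
  equation in the dual module, where the isomorphism \<open>\<omega>\<^sup>\<flat>\<close> solves it uniquely.
\<close>

lemma interior_prod_eq_iff_flat: "\<iota> x \<omega> = d (cochain0 a) \<longleftrightarrow> flat \<omega> x = (\<lambda>y. \<rho> y a)"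
proof
  assume "\<iota> x \<omega> = d (cochain0 a)"
  then show "flat \<omega> x = (\<lambda>y. \<rho> y a)" by (simp add: flat_def differential_cochain0)
next
  assume *: "flat \<omega> x = (\<lambda>y. \<rho> y a)"
  show "\<iota> x \<omega> = d (cochain0 a)"
  proof (rule cochains_1_eqI)
    show "\<iota> x \<omega> \<in> C 1" using interior_prod_in_cochains[OF \<omega>_cochain] by simp
    show "d (cochain0 a) \<in> C 1" using differential_cochains[OF cochain0_in_cochains] by simp
    show "\<iota> x \<omega> [y] = d (cochain0 a) [y]" for y
      using fun_cong[OF *, of y] by (simp add: flat_def differential_cochain0)
  qed
qed

lemma gradient_ex1: "\<exists>!x. \<iota> x \<omega> = d (cochain0 a)"
proof -
  have "module ((*) :: 'a \<Rightarrow> 'a \<Rightarrow> 'a)"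
    by unfold_locales (simp_all add: algebra_simps)
  then have "(\<lambda>y. \<rho> y a) \<in> module_dual smul"
    by (simp add: module_dual_def module_hom_iff G.module_axioms anchor_add anchor_smul)
  then obtain x where "flat \<omega> x = (\<lambda>y. \<rho> y a)"
    using bij_betw_imp_surj_on[OF flat_bij] by (metis imageE)
  then show ?thesis
    unfolding interior_prod_eq_iff_flat using bij_betw_imp_inj_on[OF flat_bij]
    by (intro ex1I[of _ x]) (simp_all add: inj_eq flip: \<open>flat \<omega> x = _\<close>)
qed

lemma interior_prod_gradient: "\<iota> (X a) \<omega> = d (cochain0 a)"
  unfolding sympl_gradient_def by (rule theI'[OF gradient_ex1])

lemma gradient_eqI: "\<iota> x \<omega> = d (cochain0 a) \<Longrightarrow> X a = x"
  using gradient_ex1 interior_prod_gradient by blast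

lemma gradient_add: "X (a + b) = X a + X b"
  by (rule gradient_eqI)
    (simp only: interior_prod_plus[OF \<omega>_cochain] interior_prod_gradient cochain0_add differential_add)

lemma gradient_scale: "X (scaleK k a) = smul (scaleK k 1) (X a)"
  by (rule gradient_eqI)
    (simp only: interior_prod_smul[OF \<omega>_cochain] interior_prod_gradient scaleK_eq[of k a]
      cochain0_mult flip: differential_scale cochain_scale_eq)

lemma br_eq: "br a b = \<rho> (X a) b"
proof -
  have "- \<omega> [X a, X b] = \<iota> (X b) \<omega> [X a]"
    using fun_cong[OF cochains_swap[OF \<omega>_cochain, of "X a" "X b"], of "[]"]
    by (simp add: interior_prod_def)
  then show ?thesis by (simp add: sympl_bracket_def interior_prod_gradient differential_cochain0)
qed

text \<open>
  Hamiltonian elements preserve the form: \<open>L\<^bsub>X\<^esub> \<omega> = d i\<^bsub>X\<^esub> \<omega> + i\<^bsub>X\<^esub> d \<omega> = d d a + 0\<close>.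
\<close>

lemma lie_deriv_gradient: "L (X a) \<omega> = 0"
  using cartan_formula[OF \<omega>_cochain, of "X a"]
  by (simp add: \<omega>_closed interior_prod_zero interior_prod_gradient
      differential_differential[OF cochain0_in_cochains])

text \<open>
  With \<open>L\<^bsub>X\<^esub> \<omega> = 0\<close> for \<open>X = X\<^sub>a\<close> one gets \<open>i\<^bsub>[X,Y]\<^esub> \<omega> = L\<^bsub>X\<^esub> i\<^bsub>Y\<^esub> \<omega> = L\<^bsub>X\<^esub> d b = d L\<^bsub>X\<^esub> b\<close> for \<open>Y = X\<^sub>b\<close>, and
  \<open>L\<^bsub>X\<^esub> b = \<rho>(X)(b) = {a, b}\<close>.
\<close>

lemma gradient_bracket: "X (br a b) = bracket (X a) (X b)"
proof (rule gradient_eqI)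
  have L: "L (X a) (cochain0 b) = cochain0 (br a b)"
    by (rule ext, subst lie_deriv_cochains_0[OF cochain0_in_cochains])
      (simp add: cochain0_def br_eq anchor_zero)
  have "\<iota> (X b) (L (X a) \<omega>) = L (X a) (\<iota> (X b) \<omega>) - \<iota> (bracket (X a) (X b)) \<omega>"
    by (rule interior_prod_lie_deriv)
  then have "\<iota> (bracket (X a) (X b)) \<omega> = L (X a) (d (cochain0 b))"
    by (simp add: lie_deriv_gradient interior_prod_zero interior_prod_gradient)
  also have "\<dots> = d (cochain0 (br a b))"
    unfolding L[symmetric] by (rule differential_lie_deriv[OF cochain0_in_cochains, symmetric])
  finally show "\<iota> (bracket (X a) (X b)) \<omega> = d (cochain0 (br a b))" .
qed

lemma jacobi_algebra_br: "jacobi_algebra scaleK br"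
proof unfold_locales
  have self: "br a a = 0" for a
    using fun_cong[OF interior_prod_self[OF \<omega>_cochain, of "X a"], of "[]"]
    by (simp add: sympl_bracket_def interior_prod_def)
  show "br a a = 0" for a by (rule self)
  show add_left: "br (a + b) c = br a c + br b c"
    and add_right: "br a (b + c) = br a b + br a c" for a b c
    by (simp_all add: br_eq gradient_add anchor_add anchor_plus)
  show "br (scaleK k a) b = scaleK k (br a b)" and "br a (scaleK k b) = scaleK k (br a b)" for k a b
    using scaleK_eq[of k "br a b"] by (simp_all add: br_eq gradient_scale anchor_smul anchor_scale)
  show "br a (b * c) = br a b * c + b * br a c - br a 1 * b * c" for a b c
    by (simp add: br_eq anchor_mult algebra_simps)
  have skew: "br a b = - br b a" for a b
    using self[of "a + b"] unfolding add_left add_right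
    by (simp add: self[of a] self[of b] eq_neg_iff_add_eq_0 add.commute)
  have neg: "br a (- b) = - br a b" for a b
    by (simp add: br_eq anchor_minus)
  have "br (br a b) c = br a (br b c) - br b (br a c)" for a b c
    by (simp add: br_eq[of "br a b"] gradient_bracket anchor_bracket commutator_def)
      (simp add: br_eq)
  then show "br a (br b c) + br b (br c a) + br c (br a b) = 0" for a b c
    unfolding skew[of c a] skew[of c "br a b"] neg by simp
qed

end

section \<open>Conformal change by a unit\<close>

context symplectic_lrj_algebra
begin

context
  fixes u u_inv :: 'a
  assumes unit: "u * u_inv = 1"
    and chi: "\<And>x. chi \<rho> x = u_inv * rho_bar \<rho> x u"
begin

lemma u_cancel: "u * (u_inv * a) = a" "u_inv * (u * a) = a"
  using unit by (metis mult.assoc mult.commute mult_1)+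

text \<open>
  The hypothesis says \<open>\<rho>'(x)(u) = u \<chi>(x)\<close>, so the term by which the derivation \<open>\<rho>'(x)\<close> differs from
  \<open>\<rho>(x)\<close> is supplied by the Leibniz rule.  All other compatibilities with \<open>u\<close> follow from this.
\<close>

lemma rho_bar_unit_mult: "rho_bar \<rho> x (u * a) = u * \<rho> x a"
proof -
  have "rho_bar \<rho> x u = u * \<rho> x 1"
    using chi[of x] by (simp add: chi_def u_cancel)
  then show ?thesis by (simp add: rho_bar_mult) (simp add: rho_bar_eq algebra_simps)
qed

lemma rho_eq_conjugate: "\<rho> x = mult_op u_inv \<circ> rho_bar \<rho> x \<circ> mult_op u"
  by (simp add: fun_eq_iff mult_op_def rho_bar_unit_mult u_cancel)

abbreviation "d' \<equiv> differential bracket (rho_bar \<rho>)"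

lemma differential_unit_mult: "d' (cochain_mult u \<beta>) = cochain_mult u (d \<beta>)"
  by (simp add: differential_def cochain_mult_def rho_bar_unit_mult fun_eq_iff sum_distrib_left
      algebra_simps)

lemma cochain_mult_cancel:
  "cochain_mult u (cochain_mult u_inv \<beta>) = \<beta>" "cochain_mult u_inv (cochain_mult u \<beta>) = \<beta>"
  by (simp_all add: cochain_mult_def u_cancel)

lemma complex_isomorphism_unit_mult:
  "complex_isomorphism (cochain_scale scaleK) C d (cochain_scale scaleK) C d' (cochain_mult u)"
proof -
  interpret bar: lie_rinehart_algebra scaleK smul bracket "rho_bar \<rho>"
    by (rule lie_rinehart_rho_bar)
  have "linear_on (cochain_scale scaleK) (cochain_scale scaleK) (C p) (cochain_mult u)" for p
    by (simp add: linear_on_def cochain_mult_add cochain_scale_eq)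
      (simp add: cochain_mult_def algebra_simps)
  moreover have "bij_betw (cochain_mult u) (C p) (C p)" for p
    by (rule bij_betw_byWitness[where f' = "cochain_mult u_inv"])
      (auto simp: cochain_mult_cancel cochains_mult)
  ultimately show ?thesis
    unfolding complex_isomorphism_def
    by (simp add: cochain_complex_differential bar.cochain_complex_differential
        differential_unit_mult)
qed

lemma symplectic_form_unit_mult:
  "symplectic_form smul bracket (rho_bar \<rho>) (cochain_mult u \<omega>)"
proof -
  have flat: "flat (cochain_mult u \<omega>) = (\<lambda>f y. u * f y) \<circ> flat \<omega>"
    by (simp add: flat_def interior_prod_def cochain_mult_def fun_eq_iff)
  have dual: "(\<lambda>y. a * f y) \<in> module_dual smul" if "f \<in> module_dual smul" for a f
    using that by (simp add: module_dual_def module_hom_iff algebra_simps)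
  have "bij_betw (\<lambda>f y. u * f y) (module_dual smul) (module_dual smul)"
    by (rule bij_betw_byWitness[where f' = "\<lambda>f y. u_inv * f y"]) (auto simp: u_cancel dual)
  then have "bij_betw (flat (cochain_mult u \<omega>)) UNIV (module_dual smul)"
    unfolding flat by (rule bij_betw_trans[OF flat_bij])
  moreover have "module_hom smul (\<lambda>a f y. a * f y) (flat (cochain_mult u \<omega>))"
    using flat_hom by (simp add: flat module_hom_iff fun_eq_iff algebra_simps)
  ultimately show ?thesis
    by (simp add: symplectic_form_def cochains_mult[OF \<omega>_cochain] differential_unit_mult \<omega>_closed
        cochain_mult_zero)
qed

lemma gradient_unit_mult:
  "X a = sympl_gradient bracket (rho_bar \<rho>) (cochain_mult u \<omega>) (u * a)"
proof -
  have "\<iota> x (cochain_mult u \<omega>) = d' (cochain0 (u * a)) \<longleftrightarrow> \<iota> x \<omega> = d (cochain0 a)" for x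
    unfolding cochain0_mult differential_unit_mult interior_prod_mult
    by (metis cochain_mult_cancel(2))
  then show ?thesis by (simp add: sympl_gradient_def)
qed

end

end

theorem proposition4p1:
  fixes scaleK :: "'k::field_char_0 \<Rightarrow> 'a::comm_ring_1 \<Rightarrow> 'a"
    and smul :: "'a \<Rightarrow> 'g::ab_group_add \<Rightarrow> 'g"
    and bracket :: "'g \<Rightarrow> 'g \<Rightarrow> 'g"
    and \<rho> :: "'g \<Rightarrow> 'a \<Rightarrow> 'a"
    and \<omega> \<Omega> :: "'g list \<Rightarrow> 'a"
    and u u_inv :: 'a
  assumes "symplectic_lrj_algebra scaleK smul bracket \<rho> \<omega>"
    and "u * u_inv = 1"
    and "\<And>x. chi \<rho> x = u_inv * rho_bar \<rho> x u"
    and "\<Omega> = cochain_mult u \<omega>"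
  shows "(\<forall>x. \<rho> x = mult_op u_inv \<circ> rho_bar \<rho> x \<circ> mult_op u) \<and>
    complex_isomorphism
      (cochain_scale scaleK) (cochains smul) (differential bracket \<rho>)
      (cochain_scale scaleK) (cochains smul) (differential bracket (rho_bar \<rho>))
      (cochain_mult u) \<and>
    (lie_rinehart_algebra scaleK smul bracket (rho_bar \<rho>) \<and>
      symplectic_form smul bracket (rho_bar \<rho>) \<Omega> \<and>
      (\<forall>a. sympl_gradient bracket \<rho> \<omega> a = sympl_gradient bracket (rho_bar \<rho>) \<Omega> (u * a))) \<and>
    (jacobi_algebra scaleK (sympl_bracket bracket \<rho> \<omega>) \<and>
      poisson_algebra scaleK (sympl_bracket bracket (rho_bar \<rho>) \<Omega>) \<and>
      lie_isomorphism scaleK (sympl_bracket bracket \<rho> \<omega>)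
        scaleK (sympl_bracket bracket (rho_bar \<rho>) \<Omega>) (\<lambda>a. u * a))"
proof -
  interpret S: symplectic_lrj_algebra scaleK smul bracket \<rho> \<omega> by (rule assms(1))
  note unit = assms(2,3)
  interpret bar: lie_rinehart_algebra scaleK smul bracket "rho_bar \<rho>"
    by (rule S.lie_rinehart_rho_bar)
  have \<Omega>: "symplectic_form smul bracket (rho_bar \<rho>) \<Omega>"
    unfolding assms(4) by (rule S.symplectic_form_unit_mult[OF unit])
  interpret \<Omega>: symplectic_lrj_algebra scaleK smul bracket "rho_bar \<rho>" \<Omega>
    by unfold_locales (rule \<Omega>)
  have gradient: "S.X a = \<Omega>.X (u * a)" for a
    unfolding assms(4) by (rule S.gradient_unit_mult[OF unit])
  interpret J: jacobi_algebra scaleK S.br by (rule S.jacobi_algebra_br)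
  interpret J': jacobi_algebra scaleK \<Omega>.br by (rule \<Omega>.jacobi_algebra_br)
  have poisson: "poisson_algebra scaleK \<Omega>.br"
  proof unfold_locales
    fix a b c
    \<comment> \<open>Derivations kill \<open>1\<close>, so the Jacobi correction term vanishes.\<close>
    have "\<Omega>.br a 1 = 0" by (simp add: \<Omega>.br_eq S.rho_bar_eq)
    then show "\<Omega>.br a (b * c) = \<Omega>.br a b * c + b * \<Omega>.br a c"
      using J'.br_mult[of a b c] by simp
  qed
  have "u * S.br a b = \<Omega>.br (u * a) (u * b)" for a b
    by (simp add: S.br_eq \<Omega>.br_eq S.rho_bar_unit_mult[OF unit] flip: gradient)
  moreover have "bij (\<lambda>a. u * a)"
    by (rule bij_betw_byWitness[where f' = "\<lambda>a. u_inv * a"])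
      (simp_all add: S.u_cancel[OF unit])
  moreover have "Vector_Spaces.linear scaleK scaleK (\<lambda>a. u * a)"
    by (simp add: Vector_Spaces.linear_iff S.A.vector_space_axioms algebra_simps)
      (metis S.A.scaleK_mult mult.commute)
  ultimately have "lie_isomorphism scaleK S.br scaleK \<Omega>.br (\<lambda>a. u * a)"
    by (simp add: lie_isomorphism_def J.lie_algebra_axioms J'.lie_algebra_axioms)
  then show ?thesis
    using S.rho_eq_conjugate[OF unit] S.complex_isomorphism_unit_mult[OF unit]
      S.lie_rinehart_rho_bar \<Omega> gradient S.jacobi_algebra_br poisson by blast
qed

end
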